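(* The minimum number of edges of a $5$-uniform intersecting hypergraph $H$ with $\tau(H)=5$ is $13$. That is, there exists a $5$-uniform intersecting hypergraph with exactly $13$ edges and covering number $5$, and every $5$-uniform intersecting hypergraph with covering number $5$ has at least $13$ edges.
   Context: Hypergraphs are finite and simple (no repeated edges). A hypergraph is $r$-uniform if every edge has exactly $r$ vertices, and intersecting if any two edges share at least one vertex. A cover of $H$ is a set of vertices meeting every edge; the covering number $\tau(H)$ is the minimum size of a cover. For an $r$-uniform intersecting hypergraph every edge is a cover, so $\tau(H)\le r$. *)

theory Defs
  imports Main
begin

text \<open>A hypergraph is given by its vertex set and its edge set. Edges form a set of sets, so
  no edge is repeated.\<close>

definition hypergraph :: "'a set \<Rightarrow> 'a set set \<Rightarrow> bool" where
  "hypergraph V E \<longleftrightarrow> finite V \<and> (\<forall>e\<in>E. e \<subseteq> V)"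

definition uniform :: "nat \<Rightarrow> 'a set set \<Rightarrow> bool" where
  "uniform r E \<longleftrightarrow> (\<forall>e\<in>E. card e = r)"

definition intersecting :: "'a set set \<Rightarrow> bool" where
  "intersecting E \<longleftrightarrow> (\<forall>e\<in>E. \<forall>f\<in>E. e \<inter> f \<noteq> {})"

definition cover :: "'a set \<Rightarrow> 'a set set \<Rightarrow> 'a set \<Rightarrow> bool" where
  "cover V E C \<longleftrightarrow> C \<subseteq> V \<and> (\<forall>e\<in>E. C \<inter> e \<noteq> {})"

text \<open>If no edge is empty, then \<open>V\<close> itself is a cover, so the minimum is attained.\<close>

definition covering_number :: "'a set \<Rightarrow> 'a set set \<Rightarrow> nat" where
  "covering_number V E = (LEAST n. \<exists>C. cover V E C \<and> card C = n)"

end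

theory Submission
  imports Defs
begin

text \<open>
  Lower bound. Pairing up edges shows that \<open>2 * k\<close> pairwise intersecting edges are covered by
  \<open>k\<close> vertices. The crucial fact is that at most 8 pairwise intersecting edges of size 5 are covered
  by 3 vertices; among at most 12 such edges some vertex misses at most 8, whence a cover of size 4.

  A family of at most 8 edges without a cover of size 3 has exactly 8 edges and maximum degree 3, and
  no two vertices of degree 3 hit 6 edges. Hence, in the dual, the stars of the vertices of degree 3
  are pairwise intersecting triples. An edge meets the other 7 edges in only 5 vertices, so by the
  pigeonhole principle some triple contains it; and as long as the triples found so far cover few
  edges, there is another one that shares only the given edge with them. Pairwise intersecting triples
  that expand in this way fit on at most 7 points, contradicting the 8 edges.
\<close>

definition star :: "'a set set \<Rightarrow> 'a \<Rightarrow> 'a set set" where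
  "star E v = {e \<in> E. v \<in> e}"

lemma finite_star [simp]: "finite E \<Longrightarrow> finite (star E v)"
  by (simp add: star_def)

lemma star_subset: "star E v \<subseteq> E"
  by (auto simp: star_def)

lemma card_Diff_star: "finite E \<Longrightarrow> card (E - star E v) = card E - card (star E v)"
  by (simp add: card_Diff_subset star_subset)

lemma intersecting_subset: "intersecting E \<Longrightarrow> D \<subseteq> E \<Longrightarrow> intersecting D"
  by (auto simp: intersecting_def)

lemma uniform_subset: "uniform r E \<Longrightarrow> D \<subseteq> E \<Longrightarrow> uniform r D"
  by (auto simp: uniform_def)

lemma ex_large_star_in_cover:
  assumes "finite C" and cover: "\<And>f. f \<in> D \<Longrightarrow> C \<inter> f \<noteq> {}" and large: "card C * d < card D"
  shows "\<exists>v\<in>C. d < card (star D v)"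
proof (rule ccontr)
  assume "\<not> ?thesis"
  then have small: "card (star D v) \<le> d" if "v \<in> C" for v
    using that by auto
  have "finite D"
    using large by (simp add: card_ge_0_finite)
  moreover have "D \<subseteq> \<Union>(star D ` C)"
    using cover by (fastforce simp: star_def)
  ultimately have "card D \<le> card (\<Union>(star D ` C))"
    using \<open>finite C\<close> by (intro card_mono) auto
  also have "\<dots> \<le> (\<Sum>v\<in>C. card (star D v))"
    by (rule card_UN_le[OF \<open>finite C\<close>])
  also have "\<dots> \<le> card C * d"
    using sum_bounded_above[of C "\<lambda>v. card (star D v)" d] small by simp
  finally show False
    using large by simp
qed

lemma ex_large_star_in_edge:
  assumes "0 < r" "uniform r E" "intersecting E" and "e \<in> E" "W \<subseteq> e"
    and D: "D \<subseteq> E - \<Union>(star E ` W)" and large: "(r - card W) * d < card D"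
  shows "\<exists>v\<in>e - W. d < card (star D v)"
proof (rule ex_large_star_in_cover)
  have "card e = r" "finite e"
    using assms(1,2,4) by (auto simp: uniform_def intro: card_ge_0_finite)
  then show "finite (e - W)" "card (e - W) * d < card D"
    using \<open>W \<subseteq> e\<close> large by (auto simp: card_Diff_subset finite_subset)
next
  fix f assume f: "f \<in> D"
  then obtain v where "v \<in> e" "v \<in> f"
    using \<open>intersecting E\<close> \<open>e \<in> E\<close> D unfolding intersecting_def by blast
  then show "(e - W) \<inter> f \<noteq> {}"
    using f D by (auto simp: star_def)
qed

lemma ex_large_star:
  assumes "0 < r" "uniform r E" "intersecting E" and large: "r * d + 1 < card E"
  shows "\<exists>v. Suc d < card (star E v)"
proof -
  have "finite E" "E \<noteq> {}"
    using large by (auto intro: card_ge_0_finite)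
  then obtain e where "e \<in> E"
    by blast
  moreover from this have "r * d < card (E - {e})"
    using large \<open>finite E\<close> by simp
  ultimately obtain v where v: "v \<in> e" "d < card (star (E - {e}) v)"
    using ex_large_star_in_edge[of r E e "{}" "E - {e}" d] assms(1-3) by auto
  then have "star E v = insert e (star (E - {e}) v)" "e \<notin> star (E - {e}) v"
    using \<open>e \<in> E\<close> by (auto simp: star_def)
  then show ?thesis
    using v \<open>finite E\<close> by (intro exI[of _ v]) simp
qed

definition coverable :: "nat \<Rightarrow> 'a set set \<Rightarrow> bool" where
  "coverable k E \<longleftrightarrow> (\<exists>C. finite C \<and> card C \<le> k \<and> (\<forall>e\<in>E. C \<inter> e \<noteq> {}))"

lemma coverable_extend:
  assumes "finite C" "coverable k (E - \<Union>(star E ` C))" "card C + k \<le> n"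
  shows "coverable n E"
proof -
  obtain B where B: "finite B" "card B \<le> k" "\<forall>e\<in>E - \<Union>(star E ` C). B \<inter> e \<noteq> {}"
    using assms(2) by (auto simp: coverable_def)
  have "(C \<union> B) \<inter> e \<noteq> {}" if "e \<in> E" for e
    using B(3) that by (cases "e \<in> \<Union>(star E ` C)") (auto simp: star_def)
  moreover have "card (C \<union> B) \<le> n"
    using card_Un_le[of C B] B(2) assms(3) by linarith
  ultimately show ?thesis
    using \<open>finite C\<close> B(1) unfolding coverable_def by (intro exI[of _ "C \<union> B"]) simp
qed

lemma coverable_by_pairing:
  assumes "finite E" "intersecting E" "card E \<le> 2 * k"
  shows "coverable k E"
  using assms
proof (induction k arbitrary: E)
  case 0
  then show ?case by (auto simp: coverable_def)
next
  case (Suc k)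
  show ?case
  proof (cases "E = {}")
    case True
    then show ?thesis by (auto simp: coverable_def)
  next
    case False
    then obtain e where "e \<in> E"
      by blast
    obtain f where "f \<in> E" and pair: "card (E - {e, f}) \<le> 2 * k"
    proof (cases "E = {e}")
      case False
      then obtain f where "f \<in> E" "f \<noteq> e"
        using \<open>e \<in> E\<close> by blast
      then show thesis
        using that[of f] Suc.prems \<open>e \<in> E\<close> by simp
    qed (use that[of e] in simp)
    obtain v where "v \<in> e \<inter> f"
      using Suc.prems(2) \<open>e \<in> E\<close> \<open>f \<in> E\<close> by (auto simp: intersecting_def)
    then have "card (E - star E v) \<le> card (E - {e, f})"
      using Suc.prems(1) \<open>e \<in> E\<close> \<open>f \<in> E\<close> by (intro card_mono) (auto simp: star_def)
    then have "coverable k (E - star E v)"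
      using Suc.prems pair by (intro Suc.IH) (auto intro: intersecting_subset)
    then show ?thesis
      using coverable_extend[of "{v}" k E "Suc k"] by simp
  qed
qed

lemma coverable_by_partial_cover:
  assumes "finite E" "intersecting E" "finite C" "card (E - \<Union>(star E ` C)) \<le> 2 * k" "card C + k \<le> n"
  shows "coverable n E"
proof (rule coverable_extend)
  show "coverable k (E - \<Union>(star E ` C))"
    using assms by (intro coverable_by_pairing) (auto intro: intersecting_subset)
qed (use assms in auto)

definition linear :: "'a set set \<Rightarrow> bool" where
  "linear E \<longleftrightarrow> (\<forall>e\<in>E. \<forall>f\<in>E. e \<noteq> f \<longrightarrow> (\<forall>u\<in>e \<inter> f. \<forall>v\<in>e \<inter> f. u = v))"

lemma linearD:
  "linear E \<Longrightarrow> e \<in> E \<Longrightarrow> f \<in> E \<Longrightarrow> u \<in> e \<Longrightarrow> u \<in> f \<Longrightarrow> v \<in> e \<Longrightarrow> v \<in> f \<Longrightarrow> u \<noteq> v \<Longrightarrow> e = f"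
  by (auto simp: linear_def)

lemma card_le_card_Int_Union_if_linear:
  assumes "linear S" "finite X" "p \<notin> X"
    and p: "\<And>A. A \<in> S \<Longrightarrow> p \<in> A" and meets: "\<And>A. A \<in> S \<Longrightarrow> X \<inter> A \<noteq> {}"
  shows "card S \<le> card (X \<inter> \<Union>S)"
proof -
  have "\<forall>A\<in>S. \<exists>x. x \<in> X \<inter> A"
    using meets by blast
  then obtain f where f: "\<forall>A\<in>S. f A \<in> X \<inter> A"
    by metis
  have "inj_on f S"
  proof (rule inj_onI)
    fix A B assume "A \<in> S" "B \<in> S" "f A = f B"
    then show "A = B"
      using linearD[OF \<open>linear S\<close>, of A B p "f A"] p f \<open>p \<notin> X\<close> by force
  qed
  then show ?thesis
    using f \<open>finite X\<close> by (intro card_inj_on_le[of f]) auto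
qed

lemma card_3_insertE:
  assumes "card A = 3" "p \<in> A" "q \<in> A" "p \<noteq> q"
  obtains a where "A = {p, q, a}" "a \<notin> {p, q}"
  using assms by (auto simp: card_3_iff)

text \<open>
  The last assumption is what the pigeonhole principle yields for the dual of an \<open>r\<close>-uniform family
  with \<open>r + 3\<close> edges: the edge \<open>p\<close> has \<open>r - card S\<close> vertices besides the centres of the stars in \<open>S\<close>, and
  these must meet all \<open>r + 3 - card (insert p (\<Union>S))\<close> remaining edges.
\<close>

locale expanding_triples =
  fixes P :: "'p set" and T :: "'p set set"
  assumes hypergraph: "hypergraph P T" and uniform: "uniform 3 T" and intersecting: "intersecting T"
    and expanding: "\<lbrakk>p \<in> P; S \<subseteq> T; \<forall>A\<in>S. p \<in> A; card (insert p (\<Union>S)) < card S + 3\<rbrakk>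
      \<Longrightarrow> \<exists>B\<in>T. p \<in> B \<and> B \<inter> \<Union>S \<subseteq> {p}"
begin

lemma finite_points: "finite P"
  using hypergraph by (simp add: hypergraph_def)

lemma triple_subset: "A \<in> T \<Longrightarrow> A \<subseteq> P"
  using hypergraph by (auto simp: hypergraph_def)

lemma finite_triples: "finite T"
  using finite_points triple_subset by (meson Pow_iff finite_Pow_iff finite_subset subsetI)

lemma card_triple: "A \<in> T \<Longrightarrow> card A = 3"
  using uniform by (simp add: uniform_def)

lemma finite_triple: "A \<in> T \<Longrightarrow> finite A"
  using card_triple by (simp add: card_ge_0_finite)

lemma triples_meet: "A \<in> T \<Longrightarrow> B \<in> T \<Longrightarrow> A \<inter> B \<noteq> {}"
  using intersecting by (simp add: intersecting_def)

lemma ex_triple_meeting_only_in: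
  assumes "A \<in> T" "p \<in> A"
  shows "\<exists>B\<in>T. p \<in> B \<and> B \<inter> A \<subseteq> {p}"
  using expanding[of p "{A}"] assms card_triple[of A] triple_subset[of A] by (auto simp: insert_absorb)

lemma ex_two_triples_meeting_only_in:
  assumes "p \<in> P"
  shows "\<exists>A\<in>T. \<exists>B\<in>T. p \<in> A \<and> p \<in> B \<and> B \<inter> A \<subseteq> {p}"
proof -
  obtain A where "A \<in> T" "p \<in> A"
    using expanding[of p "{}"] assms by auto
  then show ?thesis
    using ex_triple_meeting_only_in[of A p] by blast
qed

lemma ex_triple_meeting_two_only_in:
  assumes "A \<in> T" "B \<in> T" "A \<noteq> B" "p \<in> A" "p \<in> B" "card (A \<union> B) \<le> 4"
  shows "\<exists>C\<in>T. p \<in> C \<and> C \<inter> (A \<union> B) \<subseteq> {p}"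
  using expanding[of p "{A, B}"] assms triple_subset[of A] by (auto simp: insert_absorb)

lemma triples_around_common_pair:
  assumes pqa: "{p, q, a} \<in> T" "a \<notin> {p, q}" and pqb: "{p, q, b} \<in> T" "b \<notin> {p, q}"
    and distinct: "p \<noteq> q" "a \<noteq> b"
  obtains z c d where "{a, b, z} \<in> T" "{p, z, c} \<in> T" "{q, z, d} \<in> T"
    "z \<notin> {p, q, a, b}" "c \<notin> {p, q, a, b, z}" "d \<notin> {p, q, a, b, z}"
proof -
  obtain R where R: "R \<in> T" "a \<in> R" "R \<inter> {p, q, a} \<subseteq> {a}"
    using ex_triple_meeting_only_in[OF pqa(1), of a] by blast
  moreover have "R \<inter> {p, q, b} \<noteq> {}"
    by (rule triples_meet[OF R(1) pqb(1)])
  ultimately have "b \<in> R" "p \<notin> R" "q \<notin> R"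
    using pqa(2) by auto
  moreover obtain z where abz: "R = {a, b, z}" "z \<notin> {a, b}"
    using card_3_insertE[OF card_triple[OF R(1)] R(2) \<open>b \<in> R\<close> \<open>a \<noteq> b\<close>] .
  ultimately have z: "z \<notin> {p, q, a, b}"
    by auto
  have "\<exists>d. {u, z, d} \<in> T \<and> d \<notin> {p, q, a, b, z}" if "u \<in> {p, q}" for u
  proof -
    have "{p, q, a} \<union> {p, q, b} = {p, q, a, b}" "{p, q, a} \<noteq> {p, q, b}"
      using pqa(2) pqb(2) distinct by auto
    moreover have "card {p, q, a, b} \<le> 4"
      by (simp add: card_insert_if)
    ultimately have "\<exists>C\<in>T. u \<in> C \<and> C \<inter> {p, q, a, b} \<subseteq> {u}"
      using ex_triple_meeting_two_only_in[OF pqa(1) pqb(1), of u] that by auto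
    then obtain C where C: "C \<in> T" "u \<in> C" "C \<inter> {p, q, a, b} \<subseteq> {u}"
      by blast
    moreover have "C \<inter> {a, b, z} \<noteq> {}"
      using triples_meet[OF C(1) R(1)] abz(1) by simp
    ultimately have "z \<in> C" "u \<noteq> z"
      using that pqa(2) pqb(2) z by auto
    obtain d where "C = {u, z, d}" "d \<notin> {u, z}"
      using card_3_insertE[OF card_triple[OF C(1)] C(2) \<open>z \<in> C\<close> \<open>u \<noteq> z\<close>] .
    then show ?thesis
      using C(1,3) by (intro exI[of _ d]) auto
  qed
  from this[of p] this[of q] show thesis
    using that R(1) abz(1) z by auto
qed

lemma card_le_7_if_not_linear:
  assumes "\<not> linear T"
  shows "card P \<le> 7"
proof (rule ccontr)
  assume large: "\<not> card P \<le> 7"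
  obtain A B p q where AB: "A \<in> T" "B \<in> T" "A \<noteq> B"
    and pq: "p \<in> A" "p \<in> B" "q \<in> A" "q \<in> B" "p \<noteq> q"
    using assms by (auto simp: linear_def)
  obtain a where a: "A = {p, q, a}" "a \<notin> {p, q}"
    using card_3_insertE[OF card_triple[OF AB(1)] pq(1,3,5)] .
  obtain b where b: "B = {p, q, b}" "b \<notin> {p, q}"
    using card_3_insertE[OF card_triple[OF AB(2)] pq(2,4,5)] .
  have "a \<noteq> b"
    using a(1) b(1) AB(3) by auto
  obtain z c d where triples: "{a, b, z} \<in> T" "{p, z, c} \<in> T" "{q, z, d} \<in> T"
    and new: "z \<notin> {p, q, a, b}" "c \<notin> {p, q, a, b, z}" "d \<notin> {p, q, a, b, z}"
    using triples_around_common_pair[of p q a b] AB(1,2) a b \<open>p \<noteq> q\<close> \<open>a \<noteq> b\<close> by metis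
  have "card {p, q, a, b, z, c, d} \<le> 7"
    by (simp add: card_insert_if)
  then have "\<not> P \<subseteq> {p, q, a, b, z, c, d}"
    using large card_mono[of "{p, q, a, b, z, c, d}" P] by auto
  then obtain x where x: "x \<in> P" "x \<notin> {p, q, a, b, z, c, d}"
    by blast
  have through_z: "z \<in> X" if X: "X \<in> T" "x \<in> X" for X
  proof -
    obtain y w where "X = {x, y, w}"
      using card_triple[OF X(1)] X(2) by (auto simp: card_3_iff)
    moreover have "X \<inter> {p, q, a} \<noteq> {}" "X \<inter> {p, q, b} \<noteq> {}" "X \<inter> {a, b, z} \<noteq> {}"
      "X \<inter> {p, z, c} \<noteq> {}" "X \<inter> {q, z, d} \<noteq> {}"
      using triples_meet[OF X(1)] AB(1,2) a(1) b(1) triples by metis+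
    ultimately show ?thesis
      using x(2) a(2) b(2) new pq(5) \<open>a \<noteq> b\<close> by auto
  qed
  obtain X Y where "X \<in> T" "Y \<in> T" "x \<in> X" "x \<in> Y" "Y \<inter> X \<subseteq> {x}"
    using ex_two_triples_meeting_only_in[OF x(1)] by blast
  then show False
    using through_z[of X] through_z[of Y] x(2) by blast
qed

lemma card_Union_le_if_subset_star:
  assumes "S \<subseteq> star T p"
  shows "card (\<Union>S) \<le> 2 * card S + 1"
proof -
  have S: "A \<in> T" "p \<in> A" if "A \<in> S" for A
    using assms that by (auto simp: star_def)
  have "finite S"
    using assms finite_triples finite_star finite_subset by metis
  have "card (\<Union>A\<in>S. A - {p}) \<le> (\<Sum>A\<in>S. card (A - {p}))"
    by (rule card_UN_le[OF \<open>finite S\<close>])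
  also have "\<dots> = 2 * card S"
    using S by (simp add: card_triple)
  finally have "card (insert p (\<Union>A\<in>S. A - {p})) \<le> 2 * card S + 1"
    using card_insert_le_m1[of "2 * card S + 1" "\<Union>A\<in>S. A - {p}" p] by simp
  moreover have "\<Union>S \<subseteq> insert p (\<Union>A\<in>S. A - {p})"
    by auto
  moreover have "finite (insert p (\<Union>A\<in>S. A - {p}))"
    using \<open>finite S\<close> S finite_triple by auto
  ultimately show ?thesis
    using card_mono le_trans by blast
qed

lemma card_star_le_2_if_linear:
  assumes "linear T" and large: "7 < card P"
  shows "card (star T p) \<le> 2"
proof (rule ccontr)
  assume "\<not> ?thesis"
  then have "3 \<le> card (star T p)"
    by simp
  then obtain S where S: "S \<subseteq> star T p" "card S = 3"
    by (metis obtain_subset_with_card_n)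
  then have "S \<subseteq> T" and p: "\<And>A. A \<in> S \<Longrightarrow> p \<in> A"
    by (auto simp: star_def)
  have "finite (\<Union>S)"
    using \<open>S \<subseteq> T\<close> finite_triples finite_triple by (meson finite_Union finite_subset subsetD)
  then have "\<not> P \<subseteq> \<Union>S"
    using card_Union_le_if_subset_star[OF S(1)] S(2) large card_mono[of "\<Union>S" P] by auto
  then obtain w where w: "w \<in> P" "w \<notin> \<Union>S"
    by blast
  moreover have "S \<noteq> {}"
    using S(2) by auto
  ultimately have "w \<noteq> p"
    using p by blast
  then obtain X where X: "X \<in> T" "w \<in> X" "p \<notin> X"
    using ex_two_triples_meeting_only_in[OF w(1)] by blast
  have "linear S"
    using \<open>linear T\<close> \<open>S \<subseteq> T\<close> by (auto simp: linear_def)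
  then have "card S \<le> card (X \<inter> \<Union>S)"
    using finite_triple[OF X(1)] X(3) p
  proof (rule card_le_card_Int_Union_if_linear)
    show "X \<inter> A \<noteq> {}" if "A \<in> S" for A
      using triples_meet X(1) that \<open>S \<subseteq> T\<close> by blast
  qed
  also have "\<dots> \<le> card (X - {w})"
    using w(2) finite_triple[OF X(1)] by (intro card_mono) auto
  also have "\<dots> = 2"
    using X(2) card_triple[OF X(1)] by simp
  finally show False
    using S(2) by simp
qed

lemma card_le_7_if_linear:
  assumes "linear T"
  shows "card P \<le> 7"
proof (rule ccontr)
  assume large: "\<not> card P \<le> 7"
  have "2 \<le> card (star T p)" if p: "p \<in> P" for p
  proof -
    obtain A B where "A \<in> T" "B \<in> T" "p \<in> A" "p \<in> B" "B \<inter> A \<subseteq> {p}"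
      using ex_two_triples_meeting_only_in[OF p] by blast
    moreover from this have "A \<noteq> B"
      using card_triple[of A] card_mono[of "{p}" A] by auto
    ultimately show ?thesis
      using card_mono[of "star T p" "{A, B}"] finite_triples by (auto simp: star_def)
  qed
  then have "card P * 2 \<le> (\<Sum>p\<in>P. card (star T p))"
    using sum_bounded_below[of P 2 "\<lambda>p. card (star T p)"] by simp
  also have "\<dots> = 3 * card T"
  proof -
    have "{p \<in> P. p \<in> A} = A" if "A \<in> T" for A
      using triple_subset[OF that] by blast
    then show ?thesis
      unfolding star_def using finite_points finite_triples
      by (intro sum_multicount) (auto simp: card_triple)
  qed
  finally have "3 * 1 + 1 < card T"
    using large by simp
  then obtain p where "Suc 1 < card (star T p)"
    using ex_large_star[OF zero_less_numeral uniform intersecting] by blast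
  then show False
    using card_star_le_2_if_linear[OF assms, of p] large by simp
qed

text \<open>The Fano plane shows that the bound is sharp.\<close>

lemma card_points_le_7: "card P \<le> 7"
  using card_le_7_if_linear card_le_7_if_not_linear by blast

end

definition triple_stars :: "'a set set \<Rightarrow> 'a set set set" where
  "triple_stars E = {A. card A = 3 \<and> (\<exists>v. A = star E v)}"

lemma stars_containing_edgeE:
  assumes "S \<subseteq> range (star E)" "\<forall>A\<in>S. e \<in> A"
  obtains W where "W \<subseteq> e" "S = star E ` W" "card W = card S"
proof -
  obtain W where W: "S = star E ` W" "inj_on (star E) W"
    using assms(1) by (auto simp: subset_image_inj)
  then have "W \<subseteq> e"
    using assms(2) by (auto simp: star_def)
  then show thesis
    using that W by (simp add: card_image)
qed

lemma ex_triple_star_meeting_only_in: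
  assumes "0 < r" "uniform r E" "intersecting E" and many_edges: "r + 3 \<le> card E"
    and degree: "\<And>v. card (star E v) \<le> 3"
    and "e \<in> E" and S: "S \<subseteq> triple_stars E" "\<forall>A\<in>S. e \<in> A"
    and small: "card (insert e (\<Union>S)) < card S + 3"
  shows "\<exists>B\<in>triple_stars E. e \<in> B \<and> B \<inter> \<Union>S \<subseteq> {e}"
proof -
  have "finite E"
    using many_edges by (simp add: card_ge_0_finite)
  have "S \<subseteq> range (star E)"
    using S(1) by (auto simp: triple_stars_def)
  then obtain W where W: "W \<subseteq> e" "S = star E ` W" "card W = card S"
    using stars_containing_edgeE S(2) by metis
  define D where "D = E - insert e (\<Union>S)"
  have "insert e (\<Union>S) \<subseteq> E"
    using \<open>e \<in> E\<close> W(2) star_subset by fastforce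
  then have "card D = card E - card (insert e (\<Union>S))"
    unfolding D_def using \<open>finite E\<close> by (intro card_Diff_subset) (auto intro: finite_subset)
  moreover have "card W \<le> r"
    using assms(1,2) \<open>e \<in> E\<close> W(1) card_mono[of e W] by (auto simp: uniform_def card_ge_0_finite)
  ultimately have "(r - card W) * 1 < card D"
    using many_edges small W(3) by linarith
  then obtain v where v: "v \<in> e - W" "1 < card (star D v)"
    using ex_large_star_in_edge[of r E e W D 1] assms(1-3) \<open>e \<in> E\<close> W(1,2) by (auto simp: D_def)
  have "e \<notin> star D v" "finite (star D v)"
    using \<open>finite E\<close> by (auto simp: D_def star_def)
  then have "3 \<le> card (insert e (star D v))"
    using v(2) by simp
  moreover have "insert e (star D v) \<subseteq> star E v"
    using \<open>e \<in> E\<close> v(1) by (auto simp: D_def star_def)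
  ultimately have "star E v = insert e (star D v)" "card (star E v) = 3"
    using degree[of v] card_seteq[of "star E v" "insert e (star D v)"] \<open>finite E\<close> by force+
  then show ?thesis
    by (intro bexI[of _ "star E v"]) (auto simp: triple_stars_def D_def star_def)
qed

lemma card_le_7_if_triple_stars_intersecting:
  assumes "0 < r" "uniform r E" "intersecting E" "r + 3 \<le> card E" "\<And>v. card (star E v) \<le> 3"
    and "intersecting (triple_stars E)"
  shows "card E \<le> 7"
proof -
  have "finite E"
    using assms(4) by (simp add: card_ge_0_finite)
  then have "expanding_triples E (triple_stars E)"
    using assms ex_triple_star_meeting_only_in[OF assms(1-5)]
    by unfold_locales (auto simp: hypergraph_def uniform_def triple_stars_def star_def)
  then show ?thesis
    by (rule expanding_triples.card_points_le_7)
qed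

lemma coverable_3_if_card_le_8:
  assumes fin: "finite E" and unif: "uniform 5 E" and int: "intersecting E" and card: "card E \<le> 8"
  shows "coverable 3 E"
proof (rule ccontr)
  assume not_coverable: "\<not> coverable 3 E"
  have missed: "4 < card (E - star E v)" for v
    using coverable_by_partial_cover[OF fin int, of "{v}" 2 3] not_coverable by fastforce
  have degree: "card (star E v) \<le> 3" for v
    using card missed[of v] card_Diff_star[OF fin, of v] by linarith
  have "5 * 1 + 1 < card E"
    using coverable_by_pairing[OF fin int, of 3] not_coverable by linarith
  then obtain v where "Suc 1 < card (star E v)"
    using ex_large_star[OF zero_less_numeral unif int] by blast
  then have "card E = 8"
    using card missed[of v] card_Diff_star[OF fin, of v] by linarith
  have "intersecting (triple_stars E)"
    unfolding intersecting_def
  proof (intro ballI notI)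
    fix A B assume "A \<in> triple_stars E" "B \<in> triple_stars E" and disjoint: "A \<inter> B = {}"
    then obtain u w where A: "A = star E u" "card A = 3" and B: "B = star E w" "card B = 3"
      by (auto simp: triple_stars_def)
    have "card (E - \<Union>(star E ` {u, w})) = 2"
      using A B disjoint fin \<open>card E = 8\<close> by (simp add: card_Diff_subset card_Un_disjoint star_subset)
    moreover have "u \<noteq> w"
      using A B disjoint by auto
    ultimately show False
      using coverable_by_partial_cover[OF fin int, of "{u, w}" 1 3] not_coverable by simp
  qed
  then show False
    using card_le_7_if_triple_stars_intersecting[OF _ unif int _ degree] \<open>card E = 8\<close> by simp
qed

lemma coverable_4_if_card_le_12:
  assumes fin: "finite E" and unif: "uniform 5 E" and int: "intersecting E" and card: "card E \<le> 12"
  shows "coverable 4 E"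
proof -
  have "card E \<le> 8 \<or> 5 * 1 + 1 < card E \<and> card E \<le> 1 + 10 \<or> 5 * 2 + 1 < card E \<and> card E \<le> 2 + 10"
    using card by linarith
  then consider (small) "card E \<le> 8" | (large) d where "5 * d + 1 < card E" "card E \<le> d + 10"
    by blast
  then have "\<exists>v. card E \<le> card (star E v) + 8"
  proof cases
    case large
    then obtain v where "Suc d < card (star E v)"
      using ex_large_star[OF zero_less_numeral unif int] by blast
    then show ?thesis
      using large by (intro exI[of _ v]) simp
  qed simp
  then obtain v where "card E \<le> card (star E v) + 8"
    by blast
  then have "card (E - star E v) \<le> 8"
    using card_Diff_star[OF fin, of v] by linarith
  then have "coverable 3 (E - star E v)"
    using fin unif int by (intro coverable_3_if_card_le_8) (auto intro: intersecting_subset uniform_subset)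
  then show ?thesis
    using coverable_extend[of "{v}" 3 E 4] by simp
qed

lemma coverable_if_uniform_intersecting:
  assumes "0 < r" "uniform r E" "intersecting E"
  shows "coverable r E"
proof (cases "E = {}")
  case False
  then obtain e where "e \<in> E"
    by blast
  then show ?thesis
    using assms unfolding coverable_def uniform_def intersecting_def
    by (metis card_ge_0_finite order_refl)
qed (auto simp: coverable_def)

lemma covering_number_le_iff_coverable:
  assumes "hypergraph V E" "{} \<notin> E"
  shows "covering_number V E \<le> k \<longleftrightarrow> coverable k E"
proof
  have "cover V E V"
    using assms by (auto simp: cover_def hypergraph_def Int_absorb1)
  then have "\<exists>C. cover V E C \<and> card C = covering_number V E"
    unfolding covering_number_def
    by (intro LeastI_ex[of "\<lambda>n. \<exists>C. cover V E C \<and> card C = n"]) blast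
  then obtain C where C: "cover V E C" "card C = covering_number V E"
    by blast
  then have "finite C"
    using assms(1) by (auto simp: cover_def hypergraph_def intro: finite_subset)
  moreover assume "covering_number V E \<le> k"
  ultimately show "coverable k E"
    using C unfolding coverable_def cover_def by (intro exI[of _ C]) simp
next
  assume "coverable k E"
  then obtain C where C: "finite C" "card C \<le> k" "\<forall>e\<in>E. C \<inter> e \<noteq> {}"
    by (auto simp: coverable_def)
  have "cover V E (C \<inter> V)"
    using C(3) assms(1) by (fastforce simp: cover_def hypergraph_def)
  then have "covering_number V E \<le> card (C \<inter> V)"
    unfolding covering_number_def by (intro Least_le) blast
  also have "\<dots> \<le> card C"
    using C(1) by (intro card_mono) auto
  finally show "covering_number V E \<le> k"
    using C(2) by simp
qed

lemma intersecting_imp_empty_notin: "intersecting E \<Longrightarrow> {} \<notin> E"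
  by (auto simp: intersecting_def)

fun list_coverable :: "nat \<Rightarrow> 'a list list \<Rightarrow> bool" where
  "list_coverable k [] \<longleftrightarrow> True"
| "list_coverable 0 (e # es) \<longleftrightarrow> False"
| "list_coverable (Suc k) (e # es) \<longleftrightarrow>
    list_ex (\<lambda>v. list_coverable k (filter (\<lambda>f. \<not> List.member f v) es)) e"

lemma list_coverable_if_coverable:
  assumes "coverable k (set ` set es)"
  shows "list_coverable k es"
proof -
  obtain C where "finite C" "card C \<le> k" "\<forall>e\<in>set es. C \<inter> set e \<noteq> {}"
    using assms by (auto simp: coverable_def)
  then show ?thesis
  proof (induction k es arbitrary: C rule: list_coverable.induct)
    case (3 k e es)
    then obtain v where v: "v \<in> C" "v \<in> set e"
      by auto
    then have "list_coverable k (filter (\<lambda>f. \<not> List.member f v) es)"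
      using 3 by (intro "3.IH"[of v "C - {v}"]) auto
    then show ?case
      using v by (auto simp: list_ex_iff)
  qed auto
qed

text \<open>Found by simulated annealing on the number of disjoint pairs of edges and of covers of size 4.\<close>

definition thirteen_edges :: "nat list list" where
  "thirteen_edges = [
    [0, 1, 3, 11, 16],
    [0, 2, 4, 8, 10],
    [0, 3, 5, 12, 15],
    [1, 2, 6, 7, 15],
    [1, 5, 7, 10, 13],
    [2, 3, 13, 14, 17],
    [2, 5, 9, 12, 16],
    [3, 6, 7, 8, 9],
    [4, 5, 6, 11, 17],
    [4, 8, 13, 15, 16],
    [6, 10, 12, 16, 17],
    [7, 8, 11, 12, 14],
    [9, 10, 11, 14, 15]]"

lemma card_thirteen_edges: "card (set ` set thirteen_edges) = 13"
proof -
  have "distinct (map set thirteen_edges)" "length thirteen_edges = 13"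
    by code_simp+
  then show ?thesis
    using distinct_card by fastforce
qed

lemma uniform_thirteen_edges: "uniform 5 (set ` set thirteen_edges)"
proof -
  have "list_all (\<lambda>e. distinct e \<and> length e = 5) thirteen_edges"
    by code_simp
  then show ?thesis
    by (auto simp: uniform_def list_all_iff distinct_card)
qed

lemma intersecting_thirteen_edges: "intersecting (set ` set thirteen_edges)"
proof -
  have "list_all (\<lambda>e. list_all (\<lambda>f. list_ex (List.member f) e) thirteen_edges) thirteen_edges"
    by code_simp
  then show ?thesis
    by (fastforce simp: intersecting_def list_all_iff list_ex_iff)
qed

lemma not_coverable_4_thirteen_edges: "\<not> coverable 4 (set ` set thirteen_edges)"
proof -
  have "\<not> list_coverable 4 thirteen_edges"
    by code_simp
  then show ?thesis
    using list_coverable_if_coverable by blast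
qed

theorem mainTheorem1:
  shows "(\<exists>(V :: nat set) E. hypergraph V E \<and> uniform 5 E \<and> intersecting E \<and>
            covering_number V E = 5 \<and> card E = 13) \<and>
         (\<forall>(V :: 'a set) E. hypergraph V E \<and> uniform 5 E \<and> intersecting E \<and>
            covering_number V E = 5 \<longrightarrow> 13 \<le> card E)"
proof (intro conjI allI impI)
  let ?E = "set ` set thirteen_edges" and ?V = "\<Union>(set ` set thirteen_edges)"
  note thirteen = uniform_thirteen_edges intersecting_thirteen_edges
  have hyp: "hypergraph ?V ?E"
    by (auto simp: hypergraph_def)
  have "covering_number ?V ?E \<le> 5" "\<not> covering_number ?V ?E \<le> 4"
    using covering_number_le_iff_coverable[OF hyp intersecting_imp_empty_notin[OF thirteen(2)]]
      coverable_if_uniform_intersecting[OF _ thirteen] not_coverable_4_thirteen_edges by auto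
  then have "covering_number ?V ?E = 5"
    by linarith
  then show "\<exists>(V :: nat set) E. hypergraph V E \<and> uniform 5 E \<and> intersecting E \<and>
      covering_number V E = 5 \<and> card E = 13"
    using hyp thirteen card_thirteen_edges by blast
next
  fix V :: "'a set" and E
  assume tau_5: "hypergraph V E \<and> uniform 5 E \<and> intersecting E \<and> covering_number V E = 5"
  then have "\<not> coverable 4 E"
    using covering_number_le_iff_coverable[of V E 4] intersecting_imp_empty_notin by auto
  moreover have "finite E"
    using tau_5 by (auto simp: hypergraph_def intro: finite_subset[of E "Pow V"])
  ultimately show "13 \<le> card E"
    using coverable_4_if_card_le_12[of E] tau_5 by linarith
qed

end
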